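(* If $4$ divides $n$ and $n\ge12$, then there exists an irreducible representation of $J_n=\mathbb{C}^{S_{n-1}}\#\mathbb{C}C_n$ of dimension $2$ with Frobenius-Schur indicator $-1$.
   Context: Identify $\{1,\dots,n\}$ with $\mathbb{Z}/n\mathbb{Z}$ and $S_n$ with the bijections of $\mathbb{Z}/n\mathbb{Z}$ under composition (right-to-left). $S_{n-1}$ is the subgroup of those $x$ with $x(n)=n$; $a=(1\,2\,\cdots\,n)$; $C_n=\langle a\rangle$. Each product $xa^r$ ($x\in S_{n-1}$) factors uniquely as $xa^r=(x\rhd a^r)(x\lhd a^r)$ with $x\rhd a^r\in C_n$, $x\lhd a^r\in S_{n-1}$; explicitly $x\rhd a^r=a^{x(r)}$ and $x\lhd a^r=a^{-x(r)}xa^r$. $J_n$ is the semisimple Hopf algebra over $\mathbb{C}$ with basis $p_y\#b$ ($y\in S_{n-1}$, $b\in C_n$), product $(p_y\#b)(p_z\#c)=\delta_{z,\,y\lhd b}\,p_y\#bc$, unit $\sum_y p_y\#1$, counit $\varepsilon(p_y\#b)=\delta_{y,1}$, coproduct $\Delta(p_y\#b)=\sum_{z}(p_{yz^{-1}}\#(z\rhd b))\otimes(p_z\#b)$, antipode $S(p_y\#b)=p_{(y\lhd b)^{-1}}\#(y\rhd b)^{-1}$. The Frobenius-Schur indicator of a $J_n$-module with character $\chi$ is $\nu(\chi)=\chi(\sum\Lambda_1\Lambda_2)$, where $\Lambda$ is the two-sided integral of $J_n$ with $\varepsilon(\Lambda)=1$ and $\Delta(\Lambda)=\sum\Lambda_1\otimes\Lambda_2$.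 *)

theory Defs
  imports "HOL-Analysis.Analysis" "HOL-Combinatorics.Cycles"
begin

section \<open>Finite-dimensional Hopf algebras given by structure constants\<close>

text \<open>
  Relative to a finite basis \<open>B\<close>, an element of the algebra is its coefficient function
  \<open>'b \<Rightarrow> complex\<close>, which vanishes outside \<open>B\<close>; an element of the tensor square is a
  coefficient function on pairs that vanishes outside \<open>B \<times> B\<close>. The record stores the values of
  the structure maps on basis elements.
\<close>

record 'b hopf_data =
  basis :: "'b set"
  basis_mult :: "'b \<Rightarrow> 'b \<Rightarrow> ('b \<Rightarrow> complex)"
  hunit :: "'b \<Rightarrow> complex"
  basis_counit :: "'b \<Rightarrow> complex"
  basis_comult :: "'b \<Rightarrow> ('b \<times> 'b \<Rightarrow> complex)"
  basis_antipode :: "'b \<Rightarrow> ('b \<Rightarrow> complex)"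

definition ket :: "'b \<Rightarrow> 'b \<Rightarrow> complex" where
  "ket u = (\<lambda>w. if w = u then 1 else 0)"

definition tensor :: "('b \<Rightarrow> complex) \<Rightarrow> ('b \<Rightarrow> complex) \<Rightarrow> 'b \<times> 'b \<Rightarrow> complex" where
  "tensor f g = (\<lambda>(u, v). f u * g v)"

definition hcarrier :: "'b hopf_data \<Rightarrow> ('b \<Rightarrow> complex) set" where
  "hcarrier H = {f. \<forall>u. u \<notin> basis H \<longrightarrow> f u = 0}"

text \<open>The multiplication as a linear map on the tensor square.\<close>

definition mult_map :: "'b hopf_data \<Rightarrow> ('b \<times> 'b \<Rightarrow> complex) \<Rightarrow> 'b \<Rightarrow> complex" where
  "mult_map H t = (\<lambda>w. \<Sum>u\<in>basis H. \<Sum>v\<in>basis H. t (u, v) * basis_mult H u v w)"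

definition hmult :: "'b hopf_data \<Rightarrow> ('b \<Rightarrow> complex) \<Rightarrow> ('b \<Rightarrow> complex) \<Rightarrow> 'b \<Rightarrow> complex" where
  "hmult H f g = mult_map H (tensor f g)"

definition counit :: "'b hopf_data \<Rightarrow> ('b \<Rightarrow> complex) \<Rightarrow> complex" where
  "counit H f = (\<Sum>u\<in>basis H. f u * basis_counit H u)"

definition comult :: "'b hopf_data \<Rightarrow> ('b \<Rightarrow> complex) \<Rightarrow> 'b \<times> 'b \<Rightarrow> complex" where
  "comult H f = (\<lambda>w. \<Sum>u\<in>basis H. f u * basis_comult H u w)"

definition antipode :: "'b hopf_data \<Rightarrow> ('b \<Rightarrow> complex) \<Rightarrow> 'b \<Rightarrow> complex" where
  "antipode H f = (\<lambda>w. \<Sum>u\<in>basis H. f u * basis_antipode H u w)"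

definition normalized_integral :: "'b hopf_data \<Rightarrow> ('b \<Rightarrow> complex) \<Rightarrow> bool" where
  "normalized_integral H L \<longleftrightarrow>
     L \<in> hcarrier H \<and>
     (\<forall>h\<in>hcarrier H. hmult H h L = (\<lambda>w. counit H h * L w)
                     \<and> hmult H L h = (\<lambda>w. counit H h * L w)) \<and>
     counit H L = 1"

definition the_integral :: "'b hopf_data \<Rightarrow> 'b \<Rightarrow> complex" where
  "the_integral H = (THE L. normalized_integral H L)"

lemma the_integral_eqI:
  assumes "normalized_integral H L"
  shows "the_integral H = L"
  unfolding the_integral_def
proof (rule the_equality)
  fix L' assume L': "normalized_integral H L'"
  have "hmult H L' L = (\<lambda>w. counit H L' * L w)" "hmult H L' L = (\<lambda>w. counit H L * L' w)"
    using assms L' unfolding normalized_integral_def by blast+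
  moreover have "counit H L' = 1" "counit H L = 1"
    using assms L' unfolding normalized_integral_def by blast+
  ultimately show "L' = L" by simp
qed (rule assms)

definition FS_indicator :: "'b hopf_data \<Rightarrow> (('b \<Rightarrow> complex) \<Rightarrow> complex) \<Rightarrow> complex" where
  "FS_indicator H ch = ch (mult_map H (comult H (the_integral H)))"

subsection \<open>Representations\<close>

definition representation ::
  "'b hopf_data \<Rightarrow> (('b \<Rightarrow> complex) \<Rightarrow> complex ^ 'd ^ 'd) \<Rightarrow> bool" where
  "representation H \<rho> \<longleftrightarrow>
     (\<forall>f\<in>hcarrier H. \<forall>g\<in>hcarrier H. \<rho> (\<lambda>u. f u + g u) = \<rho> f + \<rho> g) \<and>
     (\<forall>c. \<forall>f\<in>hcarrier H. \<rho> (\<lambda>u. c * f u) = (\<chi> i j. c * \<rho> f $ i $ j)) \<and>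
     \<rho> (hunit H) = mat 1 \<and>
     (\<forall>f\<in>hcarrier H. \<forall>g\<in>hcarrier H. \<rho> (hmult H f g) = \<rho> f ** \<rho> g)"

text \<open>The underlying space \<open>complex ^ 'd\<close> is nonzero because index types are nonempty.\<close>

definition irreducible_representation ::
  "'b hopf_data \<Rightarrow> (('b \<Rightarrow> complex) \<Rightarrow> complex ^ 'd ^ 'd) \<Rightarrow> bool" where
  "irreducible_representation H \<rho> \<longleftrightarrow>
     representation H \<rho> \<and>
     (\<forall>W. vec.subspace W \<and> (\<forall>f\<in>hcarrier H. \<forall>w\<in>W. \<rho> f *v w \<in> W) \<longrightarrow> W = {0} \<or> W = UNIV)"

definition character :: "(('b \<Rightarrow> complex) \<Rightarrow> complex ^ 'd ^ 'd) \<Rightarrow> ('b \<Rightarrow> complex) \<Rightarrow> complex" where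
  "character \<rho> = (\<lambda>f. trace (\<rho> f))"

section \<open>The factorization of the symmetric group\<close>

text \<open>
  The set \<open>{1..n}\<close> represents the residues modulo \<open>n\<close>, and permutations of it are extended by
  the identity to all of \<open>nat\<close>.
\<close>

type_synonym perm = "nat \<Rightarrow> nat"

definition Sym_stab :: "nat \<Rightarrow> perm set" where
  "Sym_stab n = {x. x permutes {1..n} \<and> x n = n}"

definition acyc :: "nat \<Rightarrow> perm" where
  "acyc n = cycle_of_list [1..<Suc n]"

definition Cyc :: "nat \<Rightarrow> perm set" where
  "Cyc n = {acyc n ^^ r | r. True}"

text \<open>
  The factorization \<open>x b = (x \<rhd> b) (x \<lhd> b)\<close> with \<open>x \<rhd> b\<close> in the cyclic group and \<open>x \<lhd> b\<close> in
  the point stabilizer.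
\<close>

definition ract :: "nat \<Rightarrow> perm \<Rightarrow> perm \<Rightarrow> perm" where
  "ract n x b = (THE c. c \<in> Cyc n \<and> (\<exists>y\<in>Sym_stab n. x \<circ> b = c \<circ> y))"

definition lact :: "nat \<Rightarrow> perm \<Rightarrow> perm \<Rightarrow> perm" where
  "lact n x b = (THE y. y \<in> Sym_stab n \<and> (\<exists>c\<in>Cyc n. x \<circ> b = c \<circ> y))"

lemma acyc_pow: "k < n \<Longrightarrow> (acyc n ^^ r) (Suc k) = Suc ((k + r) mod n)"
proof -
  assume k: "k < n"
  let ?cs = "[1..<Suc n]"
  have "map (acyc n ^^ r) ?cs ! k = rotate r ?cs ! k"
    unfolding acyc_def by (subst cyclic_rotation) simp_all
  moreover have "rotate r ?cs ! k = ?cs ! ((r + k) mod n)"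
    using k by (subst nth_rotate) (simp_all del: upt_Suc)
  ultimately show ?thesis
    using k by (simp add: add.commute del: upt_Suc)
qed

lemma acyc_pow_permutes: "(acyc n ^^ r) permutes {1..n}"
proof -
  have "acyc n permutes {1..n}"
    using cycle_permutes[of "[1..<Suc n]"] unfolding acyc_def
    by (simp add: atLeastLessThanSuc_atLeastAtMost del: upt_Suc)
  then show ?thesis
    by (induction r) (auto intro: permutes_compose permutes_id)
qed

lemma acyc_pow_n:
  assumes "r \<in> {1..n}" shows "(acyc n ^^ r) n = r"
proof -
  obtain m s where ms: "n = Suc m" "r = Suc s" "s \<le> m"
    using assms by (cases n; cases r) auto
  have "(m + Suc s) mod Suc m = (s + Suc m) mod Suc m" by (simp add: add.commute)
  also have "\<dots> = s" using ms(3) by (simp only: mod_add_self2 mod_less less_Suc_eq_le)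
  finally have "(m + Suc s) mod Suc m = s" .
  then show ?thesis using acyc_pow[of m n r] ms by simp
qed

lemma Cyc_eq_pow:
  assumes "n > 0" "c \<in> Cyc n" shows "c n \<in> {1..n}" and "c = acyc n ^^ (c n)"
proof -
  obtain r where r: "c = acyc n ^^ r" using assms(2) by (auto simp: Cyc_def)
  have p: "c permutes {1..n}" unfolding r by (rule acyc_pow_permutes)
  show cn: "c n \<in> {1..n}" using permutes_in_image[OF p, of n] assms(1) by simp
  obtain m where m: "n = Suc m" using assms(1) by (cases n) auto
  show "c = acyc n ^^ (c n)"
  proof
    fix i
    show "c i = (acyc n ^^ (c n)) i"
    proof (cases "i \<in> {1..n}")
      case True
      then obtain k where k: "i = Suc k" "k < n" by (cases i) auto
      have "c n = Suc ((m + r) mod n)" using acyc_pow[of m n r] r m by simp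
      then have "(k + c n) mod n = (Suc k + (m + r) mod n) mod n" by simp
      also have "\<dots> = (Suc k + (m + r)) mod n" by (rule mod_add_right_eq)
      also have "Suc k + (m + r) = (k + r) + n" using m by simp
      also have "\<dots> mod n = (k + r) mod n" by simp
      finally show ?thesis using acyc_pow[OF k(2)] k(1) r by simp
    next
      case False
      then show ?thesis
        using permutes_not_in[OF p False] permutes_not_in[OF acyc_pow_permutes False] by simp
    qed
  qed
qed

lemma factorization_unique:
  assumes "n > 0" "c \<in> Cyc n" "c' \<in> Cyc n" "y \<in> Sym_stab n" "y' \<in> Sym_stab n"
    and "c \<circ> y = c' \<circ> y'"
  shows "c = c' \<and> y = y'"
proof -
  have "c n = c' n" using fun_cong[OF assms(6), of n] assms(4,5) by (simp add: Sym_stab_def)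
  then have "acyc n ^^ (c n) = acyc n ^^ (c' n)" by (rule arg_cong)
  from trans[OF Cyc_eq_pow(2)[OF assms(1,2)] trans[OF this Cyc_eq_pow(2)[OF assms(1,3), symmetric]]]
  have c: "c = c'" .
  have "inj c" using assms(2) permutes_inj[OF acyc_pow_permutes] by (auto simp: Cyc_def)
  moreover have "c (y i) = c (y' i)" for i using fun_cong[OF assms(6), of i] c by simp
  ultimately have "y = y'" by (intro ext) (rule injD)
  with c show ?thesis by simp
qed

lemma factorization_explicit:
  assumes "r \<in> {1..n}" "x \<in> Sym_stab n"
  shows "ract n x (acyc n ^^ r) = acyc n ^^ (x r)"
    and "lact n x (acyc n ^^ r) = inv (acyc n ^^ (x r)) \<circ> x \<circ> acyc n ^^ r"
proof -
  have n: "n > 0" using assms(1) by simp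
  let ?b = "acyc n ^^ r" and ?c = "acyc n ^^ (x r)"
  let ?y = "inv ?c \<circ> x \<circ> ?b"
  have x: "x permutes {1..n}" using assms(2) by (simp add: Sym_stab_def)
  have xr: "x r \<in> {1..n}" using permutes_in_image[OF x] assms(1) by blast
  have C: "?c \<in> Cyc n" by (auto simp: Cyc_def)
  have pc: "?c permutes {1..n}" by (rule acyc_pow_permutes)
  have "inv ?c (x r) = n"
    using acyc_pow_n[OF xr] permutes_inverses(2)[OF pc, of n] by simp
  then have "?y n = n" using acyc_pow_n[OF assms(1)] by simp
  moreover have "?y permutes {1..n}"
    using x by (intro permutes_compose permutes_inv acyc_pow_permutes)
  ultimately have Y: "?y \<in> Sym_stab n" by (simp add: Sym_stab_def)
  have e: "x \<circ> ?b = ?c \<circ> ?y" using permutes_inverses(1)[OF pc] by (simp add: fun_eq_iff)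
  have u: "c = ?c \<and> y = ?y" if "c \<in> Cyc n" "y \<in> Sym_stab n" "x \<circ> ?b = c \<circ> y" for c y
    by (rule factorization_unique[OF n that(1) C that(2) Y trans[OF that(3)[symmetric] e]])
  show "ract n x ?b = ?c"
    unfolding ract_def
  proof (rule the_equality)
    show "?c \<in> Cyc n \<and> (\<exists>y\<in>Sym_stab n. x \<circ> ?b = ?c \<circ> y)"
      by (intro conjI C bexI[OF _ Y] e)
  qed (use u in blast)
  show "lact n x ?b = ?y"
    unfolding lact_def
  proof (rule the_equality)
    show "?y \<in> Sym_stab n \<and> (\<exists>c\<in>Cyc n. x \<circ> ?b = c \<circ> ?y)"
      by (intro conjI Y bexI[OF _ C] e)
  qed (use u in blast)
qed

section \<open>The Hopf algebra\<close>

text \<open>The pair \<open>(y, b)\<close> stands for the basis element \<open>p\<^sub>y # b\<close>.\<close>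

definition J :: "nat \<Rightarrow> (perm \<times> perm) hopf_data" where
  "J n = \<lparr>
     basis = Sym_stab n \<times> Cyc n,
     basis_mult = (\<lambda>(y, b) (z, c). if z = lact n y b then ket (y, b \<circ> c) else (\<lambda>w. 0)),
     hunit = (\<lambda>w. \<Sum>y\<in>Sym_stab n. ket (y, id) w),
     basis_counit = (\<lambda>(y, b). if y = id then 1 else 0),
     basis_comult = (\<lambda>(y, b) w. \<Sum>z\<in>Sym_stab n.
        tensor (ket (y \<circ> inv z, ract n z b)) (ket (z, b)) w),
     basis_antipode = (\<lambda>(y, b). ket (inv (lact n y b), inv (ract n y b)))
   \<rparr>"

end

theory Submission
  imports Defs
begin

text \<open>
  Let \<open>x\<close> fix the even residues and add 4 to the odd ones. Its orbit under \<open>\<lhd>\<close> is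
  \<open>{x, x\<inverse>}\<close>, with stabilizer generated by \<open>a\<^sup>2\<close>; the orbit has two elements because \<open>n\<close> is
  neither 4 nor 8. Inducing the character \<open>a\<^sup>2 \<mapsto> -1\<close> of the stabilizer gives a representation of
  dimension 2. As \<open>x \<lhd> a\<^sup>r = x\<inverse>\<close> exactly for odd \<open>r\<close>, only these \<open>r\<close> contribute to the
  indicator, and each contributes the value of the character at \<open>(x \<rhd> a\<^sup>r) a\<^sup>r = a\<^bsup>2r+4\<^esup>\<close>
  (for \<open>x\<inverse>\<close>: \<open>a\<^bsup>2r-4\<^esup>\<close>), which is \<open>-1\<close>.
\<close>

section \<open>Representations given on a basis\<close>

definition lin_ext :: "'b hopf_data \<Rightarrow> ('b \<Rightarrow> complex ^ 'd ^ 'd) \<Rightarrow> ('b \<Rightarrow> complex) \<Rightarrow> complex ^ 'd ^ 'd"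
  where "lin_ext H M f = (\<chi> i j. \<Sum>u\<in>basis H. f u * M u $ i $ j)"

lemma lin_ext_ket:
  assumes "finite (basis H)" "u \<in> basis H"
  shows "lin_ext H M (ket u) = M u"
  using assms by (simp add: lin_ext_def ket_def vec_eq_iff if_distrib[of "\<lambda>c. c * _"] sum.delta cong: if_cong)

text \<open>Both sides are bilinear in the coefficients of \<open>f\<close> and \<open>g\<close> on
  the basis, so it is enough to know products of basis elements. Neither function has to lie in
  \<open>hcarrier H\<close>, because values outside the basis are never read.\<close>

lemma lin_ext_mult:
  assumes "\<And>u v. u \<in> basis H \<Longrightarrow> v \<in> basis H \<Longrightarrow> lin_ext H M (basis_mult H u v) = M u ** M v"
  shows "lin_ext H M (hmult H f g) = lin_ext H M f ** lin_ext H M g"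
proof -
  let ?B = "basis H"
  have "(\<Sum>w\<in>?B. hmult H f g w * M w $ i $ j) =
      (\<Sum>k\<in>UNIV. (\<Sum>u\<in>?B. f u * M u $ i $ k) * (\<Sum>v\<in>?B. g v * M v $ k $ j))" for i j
  proof -
    have "(\<Sum>w\<in>?B. hmult H f g w * M w $ i $ j) =
        (\<Sum>w\<in>?B. \<Sum>u\<in>?B. \<Sum>v\<in>?B. f u * g v * (basis_mult H u v w * M w $ i $ j))"
      by (simp add: hmult_def mult_map_def tensor_def sum_distrib_right mult.assoc)
    also have "\<dots> = (\<Sum>u\<in>?B. \<Sum>w\<in>?B. \<Sum>v\<in>?B. f u * g v * (basis_mult H u v w * M w $ i $ j))"
      by (rule sum.swap)
    also have "\<dots> = (\<Sum>u\<in>?B. \<Sum>v\<in>?B. \<Sum>w\<in>?B. f u * g v * (basis_mult H u v w * M w $ i $ j))"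
      by (intro sum.cong refl sum.swap)
    also have "\<dots> = (\<Sum>u\<in>?B. \<Sum>v\<in>?B. f u * g v * lin_ext H M (basis_mult H u v) $ i $ j)"
      by (simp add: lin_ext_def sum_distrib_left)
    also have "\<dots> = (\<Sum>u\<in>?B. \<Sum>v\<in>?B. f u * g v * (M u ** M v) $ i $ j)"
      by (simp add: assms)
    also have "\<dots> = (\<Sum>u\<in>?B. \<Sum>v\<in>?B. \<Sum>k\<in>UNIV. (f u * M u $ i $ k) * (g v * M v $ k $ j))"
      by (simp add: matrix_matrix_mult_def sum_distrib_left mult_ac)
    also have "\<dots> = (\<Sum>u\<in>?B. \<Sum>k\<in>UNIV. \<Sum>v\<in>?B. (f u * M u $ i $ k) * (g v * M v $ k $ j))"
      by (intro sum.cong refl sum.swap)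
    also have "\<dots> = (\<Sum>k\<in>UNIV. \<Sum>u\<in>?B. \<Sum>v\<in>?B. (f u * M u $ i $ k) * (g v * M v $ k $ j))"
      by (rule sum.swap)
    finally show ?thesis by (simp add: sum_product)
  qed
  then show ?thesis by (simp add: lin_ext_def matrix_matrix_mult_def vec_eq_iff)
qed

lemma representation_lin_ext:
  assumes "\<And>u v. u \<in> basis H \<Longrightarrow> v \<in> basis H \<Longrightarrow> lin_ext H M (basis_mult H u v) = M u ** M v"
    and "lin_ext H M (hunit H) = mat 1"
  shows "representation H (lin_ext H M)"
  using lin_ext_mult[OF assms(1)] assms(2)
  by (simp add: representation_def, simp add: lin_ext_def vec_eq_iff algebra_simps sum.distrib sum_distrib_left)

lemma character_lin_ext:
  "character (lin_ext H M) f = (\<Sum>u\<in>basis H. f u * trace (M u))"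
  unfolding character_def trace_def lin_ext_def
  by (simp add: sum_distrib_left) (rule sum.swap)

section \<open>The cyclic group and the factorization\<close>

lemma acyc_pow_in_Cyc [simp]: "acyc n ^^ r \<in> Cyc n"
  by (auto simp: Cyc_def)

lemma id_in_Cyc [simp]: "id \<in> Cyc n"
  using acyc_pow_in_Cyc[where r = 0] by (simp del: acyc_pow_in_Cyc)

lemma comp_in_Cyc: "b \<in> Cyc n \<Longrightarrow> c \<in> Cyc n \<Longrightarrow> b \<circ> c \<in> Cyc n"
  by (auto simp: Cyc_def funpow_add[symmetric])

lemma acyc_pow_self: "acyc n ^^ n = id"
proof
  fix i
  show "(acyc n ^^ n) i = id i"
  proof (cases "i \<in> {1..n}")
    case True
    then obtain k where "i = Suc k" "k < n" by (cases i) auto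
    then show ?thesis using acyc_pow[of k n n] by simp
  next
    case False
    then show ?thesis using permutes_not_in[OF acyc_pow_permutes False] by simp
  qed
qed

lemma Cyc_eq_image:
  assumes "n > 0" shows "Cyc n = (\<lambda>r. acyc n ^^ r) ` {1..n}"
  using Cyc_eq_pow[OF assms] acyc_pow_in_Cyc by blast

text \<open>Evaluation at \<open>n\<close> recovers the exponent, which is why exponents run over
  \<open>{1..n}\<close> and not over \<open>{0..<n}\<close>.\<close>

lemma inj_on_acyc_pow: "inj_on (\<lambda>r. acyc n ^^ r) {1..n}"
  by (rule inj_on_inverseI[where g = "\<lambda>c. c n"]) (rule acyc_pow_n)

lemma finite_Cyc: "n > 0 \<Longrightarrow> finite (Cyc n)"
  by (simp add: Cyc_eq_image)

lemma card_Cyc: "n > 0 \<Longrightarrow> card (Cyc n) = n"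
  by (simp only: Cyc_eq_image card_image[OF inj_on_acyc_pow]) simp

lemma Cyc_permutes: "b \<in> Cyc n \<Longrightarrow> b permutes {1..n}"
  unfolding Cyc_def using acyc_pow_permutes by blast

lemma Cyc_commute: "b \<in> Cyc n \<Longrightarrow> c \<in> Cyc n \<Longrightarrow> b \<circ> c = c \<circ> b"
  by (auto simp: Cyc_def funpow_add[symmetric] add.commute)

text \<open>Translation invariance of sums over the cyclic group; this is what makes the average
  over \<open>Cyc n\<close> absorb group elements in the integral.\<close>

lemma bij_betw_Cyc_comp:
  assumes n: "n > 0" and b: "b \<in> Cyc n"
  shows "bij_betw ((\<circ>) b) (Cyc n) (Cyc n)"
  unfolding bij_betw_def
proof (rule conjI)
  show inj: "inj_on ((\<circ>) b) (Cyc n)"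
    using fun.inj_map[OF permutes_inj[OF Cyc_permutes[OF b]]] by (rule inj_on_subset) simp
  show "(\<circ>) b ` Cyc n = Cyc n"
    by (rule endo_inj_surj[OF finite_Cyc[OF n] _ inj]) (auto intro: comp_in_Cyc b)
qed

section \<open>The point stabilizer and the action of the cyclic group on it\<close>

lemma finite_Sym_stab: "finite (Sym_stab n)"
  by (rule finite_subset[OF _ finite_permutations[of "{1..n}"]]) (auto simp: Sym_stab_def)

lemma id_in_Sym_stab [simp]: "id \<in> Sym_stab n"
  by (simp add: Sym_stab_def permutes_id)

lemma inv_in_Sym_stab:
  assumes "y \<in> Sym_stab n" shows "inv y \<in> Sym_stab n"
  using assms permutes_inv_eq[of y "{1..n}"] by (auto simp: Sym_stab_def intro: permutes_inv)

lemma factorization: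
  assumes "n > 0" "y \<in> Sym_stab n" "b \<in> Cyc n"
  shows "lact n y b \<in> Sym_stab n" "ract n y b \<in> Cyc n" "y \<circ> b = ract n y b \<circ> lact n y b"
proof -
  define r where "r = b n"
  have r: "r \<in> {1..n}" and b: "b = acyc n ^^ r"
    using Cyc_eq_pow[OF assms(1,3)] unfolding r_def by auto
  let ?c = "acyc n ^^ (y r)"
  have y: "y permutes {1..n}" using assms(2) by (simp add: Sym_stab_def)
  have pc: "?c permutes {1..n}" by (rule acyc_pow_permutes)
  note e = factorization_explicit[OF r assms(2), folded b]
  have yr: "y r \<in> {1..n}" using permutes_in_image[OF y] r by blast
  have "lact n y b permutes {1..n}"
    unfolding e using y Cyc_permutes[OF assms(3)] pc by (intro permutes_compose permutes_inv)
  moreover have "lact n y b n = n"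
    using acyc_pow_n[OF yr] permutes_inverses(2)[OF pc, of n] by (simp add: e r_def)
  ultimately show "lact n y b \<in> Sym_stab n" by (simp add: Sym_stab_def)
  show "ract n y b \<in> Cyc n" by (simp add: e)
  show "y \<circ> b = ract n y b \<circ> lact n y b"
    using permutes_inverses(1)[OF pc] by (simp add: e fun_eq_iff)
qed

text \<open>Both actions are defined by \<open>THE\<close>. By uniqueness, exhibiting any one
  factorization computes them, and the later evaluations all go this way.\<close>

lemma factorization_eqI:
  assumes "n > 0" "y \<in> Sym_stab n" "b \<in> Cyc n"
    and "c \<in> Cyc n" "z \<in> Sym_stab n" "y \<circ> b = c \<circ> z"
  shows "ract n y b = c" "lact n y b = z"
  using factorization_unique[OF assms(1) factorization(2)[OF assms(1-3)] assms(4)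
      factorization(1)[OF assms(1-3)] assms(5)] factorization(3)[OF assms(1-3)] assms(6) by auto

lemma lact_id_left:
  assumes "n > 0" "b \<in> Cyc n" shows "lact n id b = id"
  using assms by (intro factorization_eqI[where c = b]) auto

lemma lact_id_right:
  assumes "n > 0" "y \<in> Sym_stab n" shows "lact n y id = y"
  using assms by (intro factorization_eqI[where c = id]) auto

text \<open>Factoring \<open>y \<circ> b\<close> and then moving \<open>c\<close> past the
  stabilizer part gives a factorization of \<open>y \<circ> (b \<circ> c)\<close>; hence
  \<open>lact n\<close> is a right action.\<close>

lemma lact_comp:
  assumes "n > 0" "y \<in> Sym_stab n" "b \<in> Cyc n" "c \<in> Cyc n"
  shows "lact n y (b \<circ> c) = lact n (lact n y b) c"
proof (rule factorization_eqI(2)[OF assms(1,2)])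
  let ?z = "lact n y b"
  note f = factorization[OF assms(1-3)]
  note g = factorization[OF assms(1) f(1) assms(4)]
  show "ract n y b \<circ> ract n ?z c \<in> Cyc n" using f g by (intro comp_in_Cyc)
  show "lact n ?z c \<in> Sym_stab n" by (rule g)
  show "y \<circ> (b \<circ> c) = (ract n y b \<circ> ract n ?z c) \<circ> lact n ?z c"
    using f(3) g(3) by (metis comp_assoc)
qed (intro comp_in_Cyc assms)

text \<open>If the stabilizer part of \<open>y \<circ> b\<close> is trivial, then \<open>y\<close>
  lies in the cyclic group, which meets the stabilizer only in \<open>id\<close>.\<close>

lemma lact_eq_id_iff:
  assumes "n > 0" "y \<in> Sym_stab n" "b \<in> Cyc n"
  shows "lact n y b = id \<longleftrightarrow> y = id"
proof
  assume "lact n y b = id"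
  then have e: "y \<circ> b = ract n y b \<circ> id" using factorization(3)[OF assms] by simp
  \<comment> \<open>Since \<open>b\<close> is the power of the cycle with exponent
    \<open>b n\<close>, the power with exponent \<open>?k\<close> is its inverse.\<close>
  let ?k = "n - b n"
  have b: "b = acyc n ^^ (b n)" "b n \<le> n" using Cyc_eq_pow[OF assms(1,3)] by auto
  have "b \<circ> acyc n ^^ ?k = acyc n ^^ (b n) \<circ> acyc n ^^ ?k" using b(1) by simp
  also have "\<dots> = id" using b(2) by (simp add: funpow_add[symmetric] acyc_pow_self)
  finally have "y = y \<circ> b \<circ> acyc n ^^ ?k" by (simp add: comp_assoc)
  also have "\<dots> = ract n y b \<circ> acyc n ^^ ?k" using e by simp
  finally have "id \<circ> y = (ract n y b \<circ> acyc n ^^ ?k) \<circ> id" by simp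
  from factorization_unique[OF assms(1) _ _ assms(2) _ this]
  show "y = id" using factorization(2)[OF assms] by (simp add: comp_in_Cyc)
qed (simp add: lact_id_left assms)

section \<open>The integral and the indicator\<close>

lemma basis_J [simp]: "basis (J n) = Sym_stab n \<times> Cyc n"
  by (simp add: J_def)

lemma basis_mult_J [simp]:
  "basis_mult (J n) (y, b) (z, c) = (if z = lact n y b then ket (y, b \<circ> c) else (\<lambda>w. 0))"
  by (simp add: J_def)

text \<open>The normalized integral of the function algebra, the point mass at \<open>id\<close>,
  combined with that of the group algebra, the uniform average.\<close>

definition J_integral :: "nat \<Rightarrow> perm \<times> perm \<Rightarrow> complex" where
  "J_integral n = (\<lambda>(y, b). if y = id \<and> b \<in> Cyc n then 1 / of_nat n else 0)"

lemma sum_J_integral: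
  assumes "n > 0"
  shows "(\<Sum>v\<in>Sym_stab n \<times> Cyc n. J_integral n v * F v) = (\<Sum>c\<in>Cyc n. F (id, c)) / of_nat n"
proof -
  have "(\<Sum>v\<in>Sym_stab n \<times> Cyc n. J_integral n v * F v) =
      (\<Sum>c\<in>Cyc n. \<Sum>y\<in>Sym_stab n. J_integral n (y, c) * F (y, c))"
    by (subst sum.swap) (simp add: sum.cartesian_product split_def)
  also have "\<dots> = (\<Sum>c\<in>Cyc n. F (id, c) / of_nat n)"
    by (intro sum.cong refl)
      (simp add: J_integral_def if_distrib[of "\<lambda>c. c * _"] sum.delta finite_Sym_stab cong: if_cong)
  finally show ?thesis by (simp add: sum_divide_distrib)
qed

lemma sum_ket_J:
  assumes "n > 0"
  shows "(\<Sum>c\<in>Cyc n. ket (id, c) w) / of_nat n = J_integral n w"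
proof -
  have "(\<Sum>c\<in>Cyc n. ket (id, c) w) = (\<Sum>c\<in>Cyc n. if c = snd w then (if fst w = id then 1 else 0) else 0)"
    by (intro sum.cong refl) (auto simp: ket_def prod_eq_iff)
  then show ?thesis using finite_Cyc[OF assms] by (simp add: J_integral_def split_def)
qed

text \<open>Multiplying by a basis element \<open>(y, b)\<close> on either side kills the integral
  unless \<open>y = id\<close>: on the left by \<open>lact_eq_id_iff\<close>, on the right because
  \<open>id\<close> is fixed by the action. For \<open>y = id\<close> the factor \<open>b\<close>
  only permutes the average over \<open>Cyc n\<close>.\<close>

lemma normalized_integral_J:
  assumes n: "n > 0"
  shows "normalized_integral (J n) (J_integral n)"
proof -
  let ?L = "J_integral n" and ?B = "Sym_stab n \<times> Cyc n"
  have shift: "(\<Sum>c\<in>Cyc n. ket (id, b \<circ> c) w) = (\<Sum>c\<in>Cyc n. ket (id, c) w)" if "b \<in> Cyc n" for b and w :: "perm \<times> perm"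
    by (rule sum.reindex_bij_betw[OF bij_betw_Cyc_comp[OF n that]])
  have cou: "basis_counit (J n) (y, b) = (if y = id then 1 else 0)" for y b
    by (simp add: J_def)
  have left: "(\<Sum>v\<in>?B. ?L v * basis_mult (J n) u v w) = basis_counit (J n) u * ?L w"
    if u': "u \<in> ?B" for u w
  proof -
    obtain y b where u: "u = (y, b)" "y \<in> Sym_stab n" "b \<in> Cyc n" using u' by auto
    have "(\<Sum>v\<in>?B. ?L v * basis_mult (J n) u v w) =
        (\<Sum>c\<in>Cyc n. basis_mult (J n) u (id, c) w) / of_nat n"
      by (rule sum_J_integral[OF n])
    also have "\<dots> = (if y = id then (\<Sum>c\<in>Cyc n. ket (id, b \<circ> c) w) / of_nat n else 0)"
      using lact_eq_id_iff[OF n u(2,3)] by (auto simp: u(1))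
    also have "\<dots> = basis_counit (J n) u * ?L w"
      using shift[OF u(3)] by (simp add: u(1) cou sum_ket_J[OF n])
    finally show ?thesis .
  qed
  have right: "(\<Sum>v\<in>?B. ?L v * basis_mult (J n) v u w) = basis_counit (J n) u * ?L w"
    if u': "u \<in> ?B" for u w
  proof -
    obtain y b where u: "u = (y, b)" "y \<in> Sym_stab n" "b \<in> Cyc n" using u' by auto
    have "(\<Sum>v\<in>?B. ?L v * basis_mult (J n) v u w) =
        (\<Sum>c\<in>Cyc n. basis_mult (J n) (id, c) u w) / of_nat n"
      by (rule sum_J_integral[OF n])
    also have "\<dots> = (if y = id then (\<Sum>c\<in>Cyc n. ket (id, b \<circ> c) w) / of_nat n else 0)"
      \<comment> \<open>The product here carries \<open>c \<circ> b\<close>; commutativity turns it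
        into the left translate that \<open>shift\<close> handles.\<close>
      using Cyc_commute[OF u(3)] by (auto simp: u(1) lact_id_left[OF n] cong: sum.cong)
    also have "\<dots> = basis_counit (J n) u * ?L w"
      using shift[OF u(3)] by (simp add: u(1) cou sum_ket_J[OF n])
    finally show ?thesis .
  qed
  have "hmult (J n) h ?L w = counit (J n) h * ?L w" for h w
  proof -
    have "hmult (J n) h ?L w = (\<Sum>u\<in>?B. h u * (\<Sum>v\<in>?B. ?L v * basis_mult (J n) u v w))"
      by (simp add: hmult_def mult_map_def tensor_def sum_distrib_left mult.assoc)
    also have "\<dots> = (\<Sum>u\<in>?B. h u * (basis_counit (J n) u * ?L w))"
      using left by (intro sum.cong) auto
    finally show ?thesis by (simp add: counit_def sum_distrib_right mult.assoc)
  qed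
  moreover have "hmult (J n) ?L h w = counit (J n) h * ?L w" for h w
  proof -
    have "hmult (J n) ?L h w = (\<Sum>v\<in>?B. \<Sum>u\<in>?B. h u * (?L v * basis_mult (J n) v u w))"
      by (simp add: hmult_def mult_map_def tensor_def mult_ac)
    also have "\<dots> = (\<Sum>u\<in>?B. \<Sum>v\<in>?B. h u * (?L v * basis_mult (J n) v u w))"
      by (rule sum.swap)
    also have "\<dots> = (\<Sum>u\<in>?B. h u * (\<Sum>v\<in>?B. ?L v * basis_mult (J n) v u w))"
      by (simp add: sum_distrib_left)
    also have "\<dots> = (\<Sum>u\<in>?B. h u * (basis_counit (J n) u * ?L w))"
      using right by (intro sum.cong) auto
    finally show ?thesis by (simp add: counit_def sum_distrib_right mult.assoc)
  qed
  moreover have "counit (J n) ?L = 1"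
    using n by (simp add: counit_def sum_J_integral cou card_Cyc)
  moreover have "?L \<in> hcarrier (J n)"
    by (auto simp: hcarrier_def J_integral_def)
  ultimately show ?thesis by (simp add: normalized_integral_def fun_eq_iff)
qed

section \<open>The indicator as a sum over the cyclic group and the stabilizer\<close>

lemma sum_tensor_ket:
  assumes "finite B" "u \<in> B" "v \<in> B"
  shows "(\<Sum>s\<in>B. \<Sum>t\<in>B. tensor (ket u) (ket v) (s, t) * F s t) = F u v"
proof -
  have "(\<Sum>s\<in>B. \<Sum>t\<in>B. tensor (ket u) (ket v) (s, t) * F s t) =
      (\<Sum>s\<in>B. if s = u then (\<Sum>t\<in>B. if t = v then F s t else 0) else 0)"
    by (intro sum.cong refl) (auto simp: tensor_def ket_def intro!: sum.cong)
  then show ?thesis using assms by (simp add: sum.delta)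
qed

text \<open>Only the basis elements \<open>(id, b)\<close> occur in the integral, so the first
  tensor factor of the coproduct is indexed by \<open>inv z\<close>. The condition under the sum is
  the one for the two tensor factors to have a nonzero product.\<close>

lemma FS_indicator_J:
  assumes n: "n > 0"
  shows "FS_indicator (J n) (character (lin_ext (J n) M)) =
    (\<Sum>b\<in>Cyc n. \<Sum>z\<in>Sym_stab n. if lact n (inv z) (ract n z b) = z
       then trace (M (inv z, ract n z b \<circ> b)) else 0) / of_nat n"
proof -
  let ?B = "Sym_stab n \<times> Cyc n"
  have finB: "finite ?B" by (simp add: finite_Sym_stab finite_Cyc[OF n])
  let ?T = "\<lambda>b z. tensor (ket (inv z, ract n z b)) (ket (z, b))"
  have com: "comult (J n) (J_integral n) w = (\<Sum>b\<in>Cyc n. \<Sum>z\<in>Sym_stab n. ?T b z w) / of_nat n" for w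
  proof -
    have "comult (J n) (J_integral n) w =
        (\<Sum>u\<in>?B. J_integral n u * basis_comult (J n) u w)"
      by (simp add: comult_def)
    also have "\<dots> = (\<Sum>b\<in>Cyc n. basis_comult (J n) (id, b) w) / of_nat n"
      by (rule sum_J_integral[OF n])
    finally show ?thesis by (simp add: J_def)
  qed
  let ?P = "\<lambda>b z. basis_mult (J n) (inv z, ract n z b) (z, b)"
  have mult: "mult_map (J n) (comult (J n) (J_integral n)) w =
      (\<Sum>b\<in>Cyc n. \<Sum>z\<in>Sym_stab n. ?P b z w) / of_nat n" for w
  proof -
    have "mult_map (J n) (comult (J n) (J_integral n)) w =
        (\<Sum>u\<in>?B. \<Sum>v\<in>?B. \<Sum>b\<in>Cyc n. \<Sum>z\<in>Sym_stab n. ?T b z (u, v) * basis_mult (J n) u v w) / of_nat n"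
      by (simp add: mult_map_def com sum_distrib_right sum_divide_distrib)
    \<comment> \<open>Merging \<open>b\<close> and \<open>z\<close> into a pair lets two plain
      exchanges bring the sums over \<open>u\<close> and \<open>v\<close> innermost, where
      \<open>sum_tensor_ket\<close> evaluates them.\<close>
    also have "(\<Sum>u\<in>?B. \<Sum>v\<in>?B. \<Sum>b\<in>Cyc n. \<Sum>z\<in>Sym_stab n. ?T b z (u, v) * basis_mult (J n) u v w) =
        (\<Sum>u\<in>?B. \<Sum>v\<in>?B. \<Sum>p\<in>Cyc n \<times> Sym_stab n. case p of (b, z) \<Rightarrow> ?T b z (u, v) * basis_mult (J n) u v w)"
      by (simp only: sum.cartesian_product)
    also have "\<dots> = (\<Sum>u\<in>?B. \<Sum>p\<in>Cyc n \<times> Sym_stab n. \<Sum>v\<in>?B. case p of (b, z) \<Rightarrow> ?T b z (u, v) * basis_mult (J n) u v w)"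
      by (intro sum.cong refl sum.swap)
    also have "\<dots> = (\<Sum>p\<in>Cyc n \<times> Sym_stab n. \<Sum>u\<in>?B. \<Sum>v\<in>?B. case p of (b, z) \<Rightarrow> ?T b z (u, v) * basis_mult (J n) u v w)"
      by (rule sum.swap)
    also have "\<dots> = (\<Sum>p\<in>Cyc n \<times> Sym_stab n. case p of (b, z) \<Rightarrow> ?P b z w)"
    proof (intro sum.cong refl, clarify)
      fix b z assume "b \<in> Cyc n" "z \<in> Sym_stab n"
      then show "(\<Sum>u\<in>?B. \<Sum>v\<in>?B. ?T b z (u, v) * basis_mult (J n) u v w) = ?P b z w"
        by (intro sum_tensor_ket finB) (auto simp: inv_in_Sym_stab factorization[OF n])
    qed
    finally show ?thesis by (simp only: sum.cartesian_product)
  qed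
  have tr: "(\<Sum>w\<in>?B. ?P b z w * trace (M w)) = (if lact n (inv z) (ract n z b) = z
       then trace (M (inv z, ract n z b \<circ> b)) else 0)" if "b \<in> Cyc n" "z \<in> Sym_stab n" for b z
  proof -
    have "(inv z, ract n z b \<circ> b) \<in> ?B"
      using that by (simp add: inv_in_Sym_stab comp_in_Cyc factorization[OF n])
    then show ?thesis
      using finB by (auto simp: ket_def if_distrib[of "\<lambda>c. c * _"] sum.delta cong: if_cong)
  qed
  have "FS_indicator (J n) (character (lin_ext (J n) M)) =
      (\<Sum>w\<in>?B. \<Sum>b\<in>Cyc n. \<Sum>z\<in>Sym_stab n. ?P b z w * trace (M w)) / of_nat n"
    by (simp add: FS_indicator_def the_integral_eqI[OF normalized_integral_J[OF n]]
        character_lin_ext mult sum_distrib_right sum_divide_distrib del: basis_mult_J)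
  also have "(\<Sum>w\<in>?B. \<Sum>b\<in>Cyc n. \<Sum>z\<in>Sym_stab n. ?P b z w * trace (M w)) =
      (\<Sum>b\<in>Cyc n. \<Sum>w\<in>?B. \<Sum>z\<in>Sym_stab n. ?P b z w * trace (M w))"
    by (rule sum.swap)
  also have "\<dots> = (\<Sum>b\<in>Cyc n. \<Sum>z\<in>Sym_stab n. \<Sum>w\<in>?B. ?P b z w * trace (M w))"
    by (intro sum.cong refl sum.swap)
  finally show ?thesis by (simp add: tr del: basis_mult_J)
qed

section \<open>Representations induced from point stabilizers\<close>

text \<open>
  Inducing \<open>\<theta>\<close>, restricted to the stabilizer of a point, gives a monomial representation on the
  orbit, enumerated by \<open>p\<close>. Nothing is lost by taking \<open>\<theta>\<close> to be defined on the whole cyclic group,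
  since characters of a subgroup extend.
\<close>

definition orbit_matrix ::
  "nat \<Rightarrow> ('d \<Rightarrow> perm) \<Rightarrow> (perm \<Rightarrow> complex) \<Rightarrow> perm \<times> perm \<Rightarrow> complex ^ 'd ^ 'd" where
  "orbit_matrix n p \<theta> = (\<lambda>(y, b). \<chi> i j. if y = p i \<and> lact n y b = p j then \<theta> b else 0)"

lemma trace_orbit_matrix:
  fixes p :: "'d::finite \<Rightarrow> perm"
  assumes "inj p"
  shows "trace (orbit_matrix n p \<theta> (y, b)) = (if y \<in> range p \<and> lact n y b = y then \<theta> b else 0)"
proof (cases "y \<in> range p")
  case True
  then obtain k where k: "y = p k" by auto
  have "trace (orbit_matrix n p \<theta> (y, b)) = (\<Sum>i\<in>UNIV. if i = k then (if lact n y b = y then \<theta> b else 0) else 0)"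
    unfolding trace_def using assms by (intro sum.cong refl) (auto simp: orbit_matrix_def k inj_eq)
  then show ?thesis using True by simp
next
  case False
  then have "y \<noteq> p i" for i by auto
  then show ?thesis using False by (simp add: trace_def orbit_matrix_def)
qed

text \<open>By transitivity every matrix unit is, up to a nonzero scalar, the image of a basis
  element. So a nonzero invariant subspace contains every coordinate vector.\<close>

lemma irreducible_orbit_representation:
  fixes p :: "'d::finite \<Rightarrow> perm"
  assumes n: "n > 0" and inj: "inj p" and p: "\<And>i. p i \<in> Sym_stab n"
    and closed: "\<And>i b. b \<in> Cyc n \<Longrightarrow> lact n (p i) b \<in> range p"
    and trans: "\<And>i j. \<exists>b\<in>Cyc n. lact n (p i) b = p j"
    and hom: "\<And>b c. b \<in> Cyc n \<Longrightarrow> c \<in> Cyc n \<Longrightarrow> \<theta> (b \<circ> c) = \<theta> b * \<theta> c"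
    and nz: "\<And>b. b \<in> Cyc n \<Longrightarrow> \<theta> b \<noteq> 0"
  shows "irreducible_representation (J n) (lin_ext (J n) (orbit_matrix n p \<theta>))"
proof -
  let ?M = "orbit_matrix n p \<theta>" and ?B = "Sym_stab n \<times> Cyc n"
  have finB: "finite ?B" by (simp add: finite_Sym_stab finite_Cyc[OF n])
  \<comment> \<open>The value at \<open>id\<close> is idempotent and nonzero.\<close>
  have one: "\<theta> id = 1" using hom[of id id] nz[of id] by simp
  have ket: "lin_ext (J n) ?M (ket u) = ?M u" if "u \<in> ?B" for u
    using that finB by (intro lin_ext_ket) auto
  have mult: "lin_ext (J n) ?M (basis_mult (J n) u v) = ?M u ** ?M v" if uv: "u \<in> ?B" "v \<in> ?B" for u v
  proof -
    obtain y b z c where u: "u = (y, b)" "y \<in> Sym_stab n" "b \<in> Cyc n"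
      and v: "v = (z, c)" "z \<in> Sym_stab n" "c \<in> Cyc n" using uv by auto
    have "lin_ext (J n) ?M (basis_mult (J n) u v) $ i $ j = (?M u ** ?M v) $ i $ j" for i j
    proof (cases "y = p i \<and> z = lact n y b")
      case True
      \<comment> \<open>Row \<open>i\<close> of the first matrix is supported in the single column
        \<open>k\<close>, so the matrix product reduces to one term.\<close>
      then obtain k where k: "z = p k" using closed[OF u(3), of i] by auto
      have "(?M u ** ?M v) $ i $ j = (\<Sum>l\<in>UNIV. ?M u $ i $ l * ?M v $ l $ j)"
        by (simp add: matrix_matrix_mult_def)
      also have "\<dots> = (\<Sum>l\<in>UNIV. if l = k then (if lact n z c = p j then \<theta> b * \<theta> c else 0) else 0)"
        using True k by (intro sum.cong refl) (auto simp: u(1) v(1) orbit_matrix_def inj_eq[OF inj])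
      also have "\<dots> = ?M (y, b \<circ> c) $ i $ j"
        using True lact_comp[OF n u(2,3) v(3)] by (simp add: orbit_matrix_def hom[OF u(3) v(3)])
      also have "\<dots> = lin_ext (J n) ?M (basis_mult (J n) u v) $ i $ j"
        using True u v by (simp add: ket comp_in_Cyc)
      finally show ?thesis ..
    next
      case False
      then have "(?M u ** ?M v) $ i $ j = 0"
        unfolding matrix_matrix_mult_def
        by (auto simp: u(1) v(1) orbit_matrix_def intro!: sum.neutral)
      moreover have "lin_ext (J n) ?M (basis_mult (J n) u v) $ i $ j = 0"
      proof (cases "z = lact n y b")
        case True
        then have "lin_ext (J n) ?M (basis_mult (J n) u v) = ?M (y, b \<circ> c)"
          using u v by (simp add: ket comp_in_Cyc)
        then show ?thesis using False True by (simp add: orbit_matrix_def)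
      qed (simp add: u(1) v(1) lin_ext_def)
      ultimately show ?thesis by simp
    qed
    then show ?thesis by (simp add: vec_eq_iff)
  qed
  have "lin_ext (J n) ?M (hunit (J n)) $ i $ j = mat 1 $ i $ j" for i j
  proof -
    have "lin_ext (J n) ?M (hunit (J n)) $ i $ j =
        (\<Sum>w\<in>?B. \<Sum>y\<in>Sym_stab n. ket (y, id) w * ?M w $ i $ j)"
      by (simp add: lin_ext_def J_def sum_distrib_right)
    also have "\<dots> = (\<Sum>y\<in>Sym_stab n. \<Sum>w\<in>?B. ket (y, id) w * ?M w $ i $ j)"
      by (rule sum.swap)
    also have "\<dots> = (\<Sum>y\<in>Sym_stab n. lin_ext (J n) ?M (ket (y, id)) $ i $ j)"
      by (simp add: lin_ext_def)
    also have "\<dots> = (\<Sum>y\<in>Sym_stab n. ?M (y, id) $ i $ j)"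
      by (simp add: ket)
    also have "\<dots> = (\<Sum>y\<in>Sym_stab n. if y = p i then (if i = j then 1 else 0) else 0)"
      using inj by (intro sum.cong refl) (auto simp: orbit_matrix_def lact_id_right[OF n] one inj_eq)
    also have "\<dots> = mat 1 $ i $ j"
      using p by (simp add: finite_Sym_stab mat_def)
    finally show ?thesis .
  qed
  then have unit: "lin_ext (J n) ?M (hunit (J n)) = mat 1" by (simp add: vec_eq_iff)
  have "representation (J n) (lin_ext (J n) ?M)"
    by (rule representation_lin_ext) (use mult unit in auto)
  moreover have "W = {0} \<or> W = UNIV"
    if W: "vec.subspace W" and inv: "\<forall>f\<in>hcarrier (J n). \<forall>w\<in>W. lin_ext (J n) ?M f *v w \<in> W"
    for W :: "(complex ^ 'd) set"
  proof (rule disjCI)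
    assume "W \<noteq> UNIV"
    show "W = {0}"
    proof (rule ccontr)
      assume "W \<noteq> {0}"
      then obtain w where w: "w \<in> W" "w \<noteq> 0" using vec.subspace_0[OF W] by auto
      then obtain i where i: "w $ i \<noteq> 0" by (auto simp: vec_eq_iff)
      have ax: "axis j 1 \<in> W" for j
      proof -
        \<comment> \<open>The matrix of \<open>(p j, b)\<close> has its only nonzero entry in row
          \<open>j\<close> and column \<open>i\<close>, so it extracts the nonzero coordinate of
          \<open>w\<close> and places it at \<open>j\<close>.\<close>
        obtain b where b: "b \<in> Cyc n" "lact n (p j) b = p i" using trans by blast
        have "ket (p j, b) \<in> hcarrier (J n)" using b(1) p by (auto simp: hcarrier_def ket_def)
        then have "?M (p j, b) *v w \<in> W" using inv w(1) b(1) p by (metis SigmaI ket)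
        moreover have "?M (p j, b) *v w = (\<theta> b * w $ i) *s axis j 1"
          using inj b(2)
          by (simp add: vec_eq_iff matrix_vector_mult_def orbit_matrix_def axis_def inj_eq
              if_distrib[of "\<lambda>c. c * _"] sum.delta cong: if_cong)
        ultimately have "(1 / (\<theta> b * w $ i)) *s ((\<theta> b * w $ i) *s axis j 1) \<in> W"
          using vec.subspace_scale[OF W] by metis
        then show ?thesis using i nz[OF b(1)] by simp
      qed
      have "x \<in> W" for x
      proof -
        have "(\<Sum>j\<in>UNIV. (x $ j) *s axis j 1) \<in> W"
          by (intro vec.subspace_sum[OF W] vec.subspace_scale[OF W] ax)
        then show ?thesis by (simp add: basis_expansion)
      qed
      with \<open>W \<noteq> UNIV\<close> show False by auto
    qed
  qed
  ultimately show ?thesis by (simp add: irreducible_representation_def)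
qed

section \<open>The two-element orbit\<close>

text \<open>Reduction modulo an even \<open>n\<close> preserves parity.\<close>

lemma even_acyc_pow:
  assumes "even n" "i \<in> {1..n}"
  shows "even ((acyc n ^^ r) i) \<longleftrightarrow> even (i + r)"
  using assms acyc_pow[of "i - 1" n r] by (auto simp: dvd_mod_iff)

text \<open>The shift \<open>s\<close> is kept as a parameter so that one family holds both orbit
  points: 4 gives one and \<open>n - 4\<close> its inverse. Using a power of the cycle avoids
  explicit modular arithmetic.\<close>

definition odd_shift :: "nat \<Rightarrow> nat \<Rightarrow> perm" where
  "odd_shift n s i = (if odd i then (acyc n ^^ s) i else i)"

lemma odd_shift_out: "i \<notin> {1..n} \<Longrightarrow> odd_shift n s i = i"
  using permutes_not_in[OF acyc_pow_permutes] by (simp add: odd_shift_def)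

lemma odd_shift_self: "odd_shift n n = id"
  by (simp add: odd_shift_def acyc_pow_self fun_eq_iff)

text \<open>An even shift \<open>t\<close> keeps odd points odd, so the second shift applies to
  exactly the same points.\<close>

lemma odd_shift_add:
  assumes "even n" "even t"
  shows "odd_shift n s \<circ> odd_shift n t = odd_shift n (s + t)"
proof
  fix i
  show "(odd_shift n s \<circ> odd_shift n t) i = odd_shift n (s + t) i"
  proof (cases "i \<in> {1..n}")
    case True
    then show ?thesis
      using even_acyc_pow[OF assms(1) True, of t] assms(2) by (simp add: odd_shift_def funpow_add)
  next
    case False
    then show ?thesis by (simp add: odd_shift_out)
  qed
qed

lemma odd_shift_comp_even:
  assumes "even n" "even r"
  shows "odd_shift n s \<circ> acyc n ^^ r = acyc n ^^ r \<circ> odd_shift n s"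
proof
  fix i
  have c: "(acyc n ^^ s) ((acyc n ^^ r) i) = (acyc n ^^ r) ((acyc n ^^ s) i)"
    by (metis add.commute comp_apply funpow_add)
  show "(odd_shift n s \<circ> acyc n ^^ r) i = (acyc n ^^ r \<circ> odd_shift n s) i"
  proof (cases "i \<in> {1..n}")
    case True
    then show ?thesis
      using even_acyc_pow[OF assms(1) True, of r] assms(2) c by (simp add: odd_shift_def)
  next
    case False
    then show ?thesis
      using permutes_not_in[OF acyc_pow_permutes False] by (simp add: odd_shift_out)
  qed
qed

text \<open>An odd rotation exchanges the parity classes, so the left side moves even points by
  \<open>r + s\<close> and odd points by \<open>r\<close>. Pulling out the rotation by
  \<open>r + s\<close> leaves the odd points to be moved back by \<open>s\<close>, that is, forward
  by \<open>n - s\<close>.\<close>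

lemma odd_shift_comp_odd:
  assumes "even n" "odd r" "s \<le> n"
  shows "odd_shift n s \<circ> acyc n ^^ r = acyc n ^^ (r + s) \<circ> odd_shift n (n - s)"
proof
  fix i
  have "acyc n ^^ (r + s) \<circ> acyc n ^^ (n - s) = acyc n ^^ r \<circ> acyc n ^^ n"
    using assms(3) by (simp add: funpow_add[symmetric])
  then have c: "(acyc n ^^ (r + s)) ((acyc n ^^ (n - s)) i) = (acyc n ^^ r) i"
    by (simp add: acyc_pow_self fun_eq_iff)
  have d: "(acyc n ^^ s) ((acyc n ^^ r) i) = (acyc n ^^ (r + s)) i"
    by (metis add.commute comp_apply funpow_add)
  show "(odd_shift n s \<circ> acyc n ^^ r) i = (acyc n ^^ (r + s) \<circ> odd_shift n (n - s)) i"
  proof (cases "i \<in> {1..n}")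
    case True
    then show ?thesis
      using even_acyc_pow[OF assms(1) True, of r] assms(2) c d by (simp add: odd_shift_def)
  next
    case False
    then show ?thesis
      using permutes_not_in[OF acyc_pow_permutes False] by (simp add: odd_shift_out)
  qed
qed

lemma odd_shift_inverse:
  assumes "even n" "even s" "s \<le> n"
  shows "odd_shift n (n - s) \<circ> odd_shift n s = id" "odd_shift n s \<circ> odd_shift n (n - s) = id"
  using assms by (simp_all add: odd_shift_add odd_shift_self)

lemma inv_odd_shift:
  assumes "even n" "even s" "s \<le> n"
  shows "inv (odd_shift n s) = odd_shift n (n - s)"
  by (rule inv_unique_comp) (use odd_shift_inverse[OF assms] in auto)

lemma odd_shift_in_Sym_stab:
  assumes "even n" "even s" "s \<le> n"
  shows "odd_shift n s \<in> Sym_stab n"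
proof -
  have "bij (odd_shift n s)" using odd_shift_inverse[OF assms] by (rule o_bij)
  then have "odd_shift n s permutes {1..n}"
    by (simp add: permutes_def bij_iff odd_shift_out)
  then show ?thesis using assms(1) by (simp add: Sym_stab_def odd_shift_def)
qed

lemma odd_shift_factorization:
  assumes "n > 0" "even n" "even s" "s \<le> n"
  shows "ract n (odd_shift n s) (acyc n ^^ r) = acyc n ^^ (if even r then r else r + s)"
    and "lact n (odd_shift n s) (acyc n ^^ r) = odd_shift n (if even r then s else n - s)"
proof -
  have e: "odd_shift n s \<circ> acyc n ^^ r = acyc n ^^ (if even r then r else r + s) \<circ>
      odd_shift n (if even r then s else n - s)"
    using assms by (simp add: odd_shift_comp_even odd_shift_comp_odd)
  show "ract n (odd_shift n s) (acyc n ^^ r) = acyc n ^^ (if even r then r else r + s)"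
    and "lact n (odd_shift n s) (acyc n ^^ r) = odd_shift n (if even r then s else n - s)"
    by (rule factorization_eqI[OF assms(1) _ _ _ _ e]; use assms in \<open>simp add: odd_shift_in_Sym_stab\<close>)+
qed

section \<open>A quartic character of the cyclic group\<close>

lemma i_power_mod_4: "\<i> ^ (r mod 4) = \<i> ^ r"
proof -
  have "\<i> ^ r = \<i> ^ (4 * (r div 4) + r mod 4)" by simp
  also have "\<dots> = (\<i> ^ 4) ^ (r div 4) * \<i> ^ (r mod 4)" by (simp only: power_add power_mult)
  finally show ?thesis by simp
qed

text \<open>An extension to \<open>Cyc n\<close> of the character that is -1 on the square of the
  cycle; \<open>b n\<close> serves as the exponent of \<open>b\<close>.\<close>

definition quartic_char :: "nat \<Rightarrow> perm \<Rightarrow> complex" where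
  "quartic_char n b = \<i> ^ b n"

text \<open>Evaluation at \<open>n\<close> recovers \<open>r\<close> only modulo \<open>n\<close>,
  which suffices because \<open>4 dvd n\<close> and the powers of \<open>\<i>\<close> have period
  4.\<close>

lemma quartic_char_acyc_pow:
  assumes "n > 0" "4 dvd n"
  shows "quartic_char n (acyc n ^^ r) = \<i> ^ r"
proof -
  have "(acyc n ^^ r) n = Suc ((n - 1 + r) mod n)"
    using acyc_pow[of "n - 1" n r] assms(1) by simp
  then have "(acyc n ^^ r) n mod n = (Suc (n - 1 + r)) mod n" by (simp only: mod_Suc_eq)
  also have "\<dots> = r mod n" using assms(1) by simp
  finally have "(acyc n ^^ r) n mod 4 = r mod 4"
    using mod_mod_cancel[OF assms(2)] by metis
  then show ?thesis unfolding quartic_char_def by (metis i_power_mod_4)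
qed

section \<open>The two-dimensional representation and its indicator\<close>

theorem corollary6p2p3:
  fixes n :: nat
  assumes "4 dvd n" and "n \<ge> 12"
  shows "\<exists>\<rho> :: (perm \<times> perm \<Rightarrow> complex) \<Rightarrow> complex ^ 2 ^ 2.
           irreducible_representation (J n) \<rho> \<and>
           FS_indicator (J n) (character \<rho>) = -1"
proof -
  have n: "n > 0" "even n" "4 \<le> n" using assms by auto
  define p :: "2 \<Rightarrow> perm" where "p = (\<lambda>i. odd_shift n (if i = 1 then 4 else n - 4))"
  let ?x = "odd_shift n 4" and ?x' = "odd_shift n (n - 4)"
  let ?\<theta> = "quartic_char n"
  let ?M = "orbit_matrix n p ?\<theta>"
  \<comment> \<open>The residue 1 separates the two points: 5 and \<open>n - 3\<close> differ
    because \<open>n \<ge> 12\<close>.\<close>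
  have "?x 1 = 5" "?x' 1 = n - 3"
    using acyc_pow[of 0 n 4] acyc_pow[of 0 n "n - 4"] assms(2) by (auto simp: odd_shift_def)
  then have ne: "?x \<noteq> ?x'" using assms(2) by auto
  have inj: "inj p"
  proof (rule injI)
    fix i j assume "p i = p j"
    then have "i = 1 \<longleftrightarrow> j = 1" using ne by (auto simp: p_def split: if_splits)
    then show "i = j" using exhaust_2[of i] exhaust_2[of j] by auto
  qed
  have range: "range p = {?x, ?x'}"
    by (simp add: p_def UNIV_2)
  \<comment> \<open>The set of shifts is closed under inversion, so both orbit points can be treated
    at once.\<close>
  have s: "s \<in> {4, n - 4} \<Longrightarrow> even s \<and> s \<le> n \<and> n - s \<in> {4, n - 4}" for s
    using n assms by auto
  have pS: "p i \<in> Sym_stab n" for i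
    unfolding p_def using n by (intro odd_shift_in_Sym_stab) auto
  have lactx: "lact n (odd_shift n s) (acyc n ^^ r) = odd_shift n (if even r then s else n - s)"
    and ractx: "ract n (odd_shift n s) (acyc n ^^ r) = acyc n ^^ (if even r then r else r + s)"
    and invx: "inv (odd_shift n s) = odd_shift n (n - s)"
    if "s \<in> {4, n - 4}" for s r
    using odd_shift_factorization[OF n(1,2)] inv_odd_shift[OF n(2)] s[OF that] by auto
  have "irreducible_representation (J n) (lin_ext (J n) ?M)"
  proof (rule irreducible_orbit_representation[OF n(1) inj pS])
    show "lact n (p i) b \<in> range p" if "b \<in> Cyc n" for i b
      using that n unfolding range by (auto simp: Cyc_def p_def lactx)
    show "\<exists>b\<in>Cyc n. lact n (p i) b = p j" for i j
    proof
      \<comment> \<open>Even powers fix both orbit points and odd powers exchange them, so the cycle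
        itself carries either point to the other.\<close>
      define r :: nat where "r = (if i = j then 0 else 1)"
      have "i = j \<longleftrightarrow> (i = 1 \<longleftrightarrow> j = 1)" using exhaust_2[of i] exhaust_2[of j] by auto
      then have "even r \<longleftrightarrow> (i = 1 \<longleftrightarrow> j = 1)" by (simp add: r_def)
      then show "lact n (p i) (acyc n ^^ r) = p j" using n by (auto simp: p_def lactx)
    qed simp
    show "?\<theta> (b \<circ> c) = ?\<theta> b * ?\<theta> c" if "b \<in> Cyc n" "c \<in> Cyc n" for b c
      using that quartic_char_acyc_pow[OF n(1) assms(1)]
      by (auto simp: Cyc_def funpow_add[symmetric] power_add)
  qed (simp add: quartic_char_def)
  moreover have "FS_indicator (J n) (character (lin_ext (J n) ?M)) = -1"
  proof -
    let ?t = "\<lambda>b z. if lact n (inv z) (ract n z b) = z then trace (?M (inv z, ract n z b \<circ> b)) else 0"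
    have t: "(\<Sum>z\<in>Sym_stab n. ?t (acyc n ^^ r) z) = (if even r then 0 else -2)" for r
    proof -
      \<comment> \<open>The trace at \<open>inv z\<close> vanishes off the orbit, and the orbit is
        closed under inversion.\<close>
      have "?t (acyc n ^^ r) z = 0" if "z \<in> Sym_stab n - {?x, ?x'}" for z
      proof -
        have "inv z \<notin> range p"
        proof
          assume "inv z \<in> range p"
          moreover have "inv (inv z) = z"
            using that by (auto simp: Sym_stab_def intro: inv_inv_eq permutes_bij)
          ultimately show False
            using that invx[of 4] invx[of "n - 4"] n unfolding range by auto
        qed
        then show ?thesis by (simp add: trace_orbit_matrix[OF inj])
      qed
      then have "(\<Sum>z\<in>Sym_stab n. ?t (acyc n ^^ r) z) = (\<Sum>z\<in>{?x, ?x'}. ?t (acyc n ^^ r) z)"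
        using finite_Sym_stab n by (intro sum.mono_neutral_right) (auto intro!: odd_shift_in_Sym_stab)
      moreover have "?t (acyc n ^^ r) (odd_shift n s) = (if even r then 0 else -1)"
        if s': "s \<in> {4, n - 4}" for s
      proof -
        have q: "n - s \<in> {4, n - 4}" "n - (n - s) = s" "even s" "4 dvd s"
          using s' n assms by auto
        have neq: "odd_shift n (n - s) \<noteq> odd_shift n s" using s' ne n by auto
        show ?thesis
        \<comment> \<open>As \<open>s\<close> is even, \<open>ract\<close> preserves the parity of
          the exponent. For even \<open>r\<close> it therefore fixes the inverse, which differs from
          the point itself, and the term vanishes; for odd \<open>r\<close> it carries the inverse
          to the point.\<close>
        proof (cases "even r")
          case True
          then show ?thesis using neq by (simp add: invx[OF s'] ractx[OF s'] lactx[OF q(1)])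
        next
          case False
          have "acyc n ^^ (r + s) \<circ> acyc n ^^ r = acyc n ^^ (2 * r + s)"
            by (simp only: funpow_add[symmetric]) (simp add: mult_2 add_ac)
          moreover have "\<i> ^ (2 * r + s) = -1"
            \<comment> \<open>The factor from \<open>s\<close> is 1 because \<open>4 dvd s\<close>,
              and \<open>\<i> ^ (2 * r)\<close> is an odd power of -1. The exponent
              \<open>2 * r + s\<close> is even, so this element fixes the orbit point and its trace
              is the character value.\<close>
            using False q(4) by (auto simp: power_add power_mult elim!: dvdE)
          ultimately show ?thesis using False q s'
            by (auto simp: invx[OF s'] ractx[OF s'] lactx[OF q(1)] trace_orbit_matrix[OF inj]
                range quartic_char_acyc_pow[OF n(1) assms(1)])
        qed
      qed
      ultimately show ?thesis using ne by simp
    qed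
    have "(\<Sum>b\<in>Cyc n. \<Sum>z\<in>Sym_stab n. ?t b z) = (\<Sum>r\<in>{1..n}. if even r then 0 else -2)"
      unfolding Cyc_eq_image[OF n(1)] sum.reindex[OF inj_on_acyc_pow]
      by (intro sum.cong refl) (simp only: o_apply t)
    also have "\<dots> = - of_nat n"
    proof -
      \<comment> \<open>Each induction step adds one odd and one even exponent, hence -2 in
        total.\<close>
      have "(\<Sum>r\<in>{1..2 * m}. if even r then 0 else -2 :: complex) = - of_nat (2 * m)" for m
        by (induction m) auto
      then show ?thesis using n(2) by (auto elim: evenE)
    qed
    finally show ?thesis using n(1) by (simp add: FS_indicator_J)
  qed
  ultimately show ?thesis by blast
qed

end
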